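(* Let $A\subset\mathbb{R}^3$ be a convex solid that is not of constant width. Then $A$ has a social butterfly as a friend with arbitrarily large length and arbitrarily small thickness. That is, for all real numbers $M>0$, $\delta>0$ and $K>1$ there exist real numbers $L,h,\varepsilon>0$ with $L\ge Kh$, $h\ge K\varepsilon$, $L>M$ and $\varepsilon<\delta$ such that the rectangular cuboid $R(L,h,\varepsilon)$ of dimensions $L\times h\times\varepsilon$ and $A$ are friends.
   Context: A convex solid is a compact convex subset of $\mathbb{R}^3$ with nonempty interior. The width of a solid in a given direction (unit vector $u$) is the distance between its two opposite parallel supporting planes perpendicular to $u$, i.e. $w_A(u)=\max_{x\in A}\langle x,u\rangle-\min_{x\in A}\langle x,u\rangle$. A convex solid has constant width if its width is the same in every direction. A social butterfly is a rectangular cuboid $R(L,h,\varepsilon)=[0,L]\times[0,h]\times[0,\varepsilon]$ (up to congruence) with $L,h,\varepsilon>0$ and $L\gg h\gg\varepsilon$; $L$ is called its length and $\varepsilon$ its thickness. The condition $L\gg h\gg\varepsilon$ is expressed here by requiring $L\ge Kh$ and $h\ge K\varepsilon$ for an arbitrary prescribed $K>1$. A convex solid $A$ can Rupert through a convex solid $B$ if a congruent copy of $A$ can pass, by a rigid translation along some direction, through a straight hole cut through $B$ along that direction, without splitting $B$ (the hole does not reach the lateral boundary of $B$). Precisely: there are unit vectors $u,v\in\mathbb{R}^3$ such that, writing $\pi_u(A)$ for the orthogonal projection of $A$ onto the plane $u^\perp$ and $\pi_v(B)$ for the orthogonal projection of $B$ onto the plane $v^\perp$, some isometric copy of $\pi_u(A)$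 in the plane $v^\perp$ (the image of $\pi_u(A)$ under an isometry $u^\perp\to v^\perp$) is contained in the interior of $\pi_v(B)$ relative to $v^\perp$. Two convex solids $A$ and $B$ (possibly $A=B$) are friends if $A$ can Rupert through $B$ and $B$ can Rupert through $A$. *)

theory Defs
  imports "HOL-Analysis.Analysis"
begin

definition convex_solid :: "(real^3) set \<Rightarrow> bool"
  where "convex_solid A \<longleftrightarrow> compact A \<and> convex A \<and> interior A \<noteq> {}"

(* For unit u and nonempty compact A, both bounds are attained. *)
definition width :: "(real^3) set \<Rightarrow> real^3 \<Rightarrow> real"
  where "width A u = (SUP x\<in>A. x \<bullet> u) - (INF x\<in>A. x \<bullet> u)"

definition constant_width :: "(real^3) set \<Rightarrow> bool"
  where "constant_width A \<longleftrightarrow>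
    convex_solid A \<and> (\<exists>w. \<forall>u. norm u = 1 \<longrightarrow> width A u = w)"

definition cuboid :: "real \<Rightarrow> real \<Rightarrow> real \<Rightarrow> (real^3) set"
  where "cuboid L h \<epsilon> = cbox 0 (vector [L, h, \<epsilon>])"

(* Orthogonal projection onto the plane u^perp, for unit u only. *)
definition plane_proj :: "real^3 \<Rightarrow> real^3 \<Rightarrow> real^3"
  where "plane_proj u x = x - (x \<bullet> u) *\<^sub>R u"

definition isometry_betw :: "('a::metric_space \<Rightarrow> 'b::metric_space) \<Rightarrow> 'a set \<Rightarrow> 'b set \<Rightarrow> bool"
  where "isometry_betw f S T \<longleftrightarrow>
    f ` S = T \<and> (\<forall>x\<in>S. \<forall>y\<in>S. dist (f x) (f y) = dist x y)"

(* The isometry is one of metric planes: it need not fix the origin, so translations within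
   the plane and reflections are included. The interior is taken in the subspace topology
   of the plane v^perp. *)
definition can_rupert :: "(real^3) set \<Rightarrow> (real^3) set \<Rightarrow> bool"
  where "can_rupert A B \<longleftrightarrow>
    (\<exists>u v f. norm u = 1 \<and> norm v = 1 \<and> isometry_betw f ({u}\<^sup>\<bottom>) ({v}\<^sup>\<bottom>) \<and>
      f ` (plane_proj u ` A) \<subseteq> top_of_set ({v}\<^sup>\<bottom>) interior_of (plane_proj v ` B))"

definition friends :: "(real^3) set \<Rightarrow> (real^3) set \<Rightarrow> bool"
  where "friends A B \<longleftrightarrow>
    convex_solid A \<and> convex_solid B \<and> can_rupert A B \<and> can_rupert B A"

lemma mem_cuboid:
  "x \<in> cuboid L h \<epsilon> \<longleftrightarrow>
    0 \<le> x$1 \<and> x$1 \<le> L \<and> 0 \<le> x$2 \<and> x$2 \<le> h \<and> 0 \<le> x$3 \<and> x$3 \<le> \<epsilon>"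
  by (auto simp: cuboid_def mem_box_cart forall_3)

lemma convex_solid_cuboid:
  assumes "L > 0" "h > 0" "\<epsilon> > 0"
  shows "convex_solid (cuboid L h \<epsilon>)"
proof -
  have "vector [L/2, h/2, \<epsilon>/2] \<in> box (0::real^3) (vector [L, h, \<epsilon>])"
    using assms by (auto simp: mem_box_cart forall_3)
  then show ?thesis
    by (auto simp: convex_solid_def cuboid_def interior_cbox)
qed

lemma plane_proj_in_plane:
  assumes "norm u = 1"
  shows "plane_proj u x \<in> {u}\<^sup>\<bottom>"
proof -
  have "u \<bullet> u = 1"
    using assms by (simp add: dot_square_norm)
  then show ?thesis
    by (simp add: plane_proj_def orthogonal_comp_def orthogonal_def inner_diff_right inner_commute)
qed

end

theory Submission
  imports Defs
begin

text \<open>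
  Since the width of \<open>A\<close> is not constant, there are a number \<open>h\<close> and two directions \<open>a\<close>, \<open>b\<close> such
  that the width of \<open>A\<close> is below \<open>h\<close> along \<open>a\<close> and above \<open>h\<close> along \<open>b\<close>. This \<open>h\<close> is the middle
  dimension of the butterfly.

  Seen along its longest edge, the butterfly is an \<open>h\<close> by \<open>\<epsilon>\<close> rectangle, a slight thickening of a
  segment of length \<open>h\<close>. As the width along \<open>b\<close> exceeds \<open>h\<close>, the solid contains two points at
  distance more than \<open>h\<close>, which can be moved into the interior. The segment between them has a
  neighbourhood inside \<open>A\<close>, so the rectangle fits once \<open>\<epsilon>\<close> is small
  (\<open>cuboid_can_rupert_between_far_points\<close>).

  Seen along its shortest edge, the butterfly is an \<open>L\<close> by \<open>h\<close> rectangle. A shadow of \<open>A\<close> in a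
  direction perpendicular to \<open>a\<close> still has width below \<open>h\<close> along \<open>a\<close>, so it fits strictly into this
  rectangle once \<open>L\<close> exceeds the diameter of \<open>A\<close> (\<open>can_rupert_cuboid_of_width_less\<close>).

  The two conditions on \<open>L\<close> and \<open>\<epsilon>\<close> are independent, and both survive making \<open>L\<close> larger and \<open>\<epsilon>\<close>
  smaller. Both passages are obtained from one rigid motion of space followed by a projection
  (\<open>can_rupert_of_rigid_motion\<close>), which avoids handling isometries between planes.
\<close>

section \<open>Passages from rigid motions of space\<close>

text \<open>
  A ball around \<open>y\<close> projects onto the disc of the same radius around the projection of \<open>y\<close>, because
  translating by a vector of the plane commutes with the projection.
\<close>

lemma plane_proj_interior_subset:
  assumes v: "norm v = 1"
  shows "plane_proj v ` interior B \<subseteq> top_of_set ({v}\<^sup>\<bottom>) interior_of (plane_proj v ` B)"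
proof
  fix x assume "x \<in> plane_proj v ` interior B"
  then obtain y where y: "y \<in> interior B" and x: "x = plane_proj v y"
    by blast
  obtain r where r: "r > 0" "ball y r \<subseteq> B"
    using y by (auto simp: mem_interior)
  have xin: "x \<in> {v}\<^sup>\<bottom>"
    unfolding x by (rule plane_proj_in_plane[OF v])
  have "{v}\<^sup>\<bottom> \<inter> ball x r \<subseteq> plane_proj v ` B"
  proof
    fix z assume z: "z \<in> {v}\<^sup>\<bottom> \<inter> ball x r"
    have "z \<bullet> v = 0" "x \<bullet> v = 0"
      using z xin by (auto simp: orthogonal_comp_def orthogonal_def inner_commute)
    then have "z = plane_proj v (y + (z - x))"
      by (simp add: plane_proj_def x inner_add_left inner_diff_left)
    moreover have "y + (z - x) \<in> ball y r"
      using z by (simp add: dist_norm norm_minus_commute)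
    ultimately show "z \<in> plane_proj v ` B"
      using r by blast
  qed
  moreover have "openin (top_of_set ({v}\<^sup>\<bottom>)) ({v}\<^sup>\<bottom> \<inter> ball x r)"
    by (simp add: openin_open_Int)
  moreover have "x \<in> {v}\<^sup>\<bottom> \<inter> ball x r"
    using xin r by simp
  ultimately show "x \<in> top_of_set ({v}\<^sup>\<bottom>) interior_of (plane_proj v ` B)"
    unfolding interior_of_def by blast
qed

text \<open>
  An orthogonal transformation \<open>T\<close> carries the plane orthogonal to \<open>u\<close> onto the plane orthogonal to
  \<open>T u\<close>, and the shadow of \<open>A\<close> along \<open>u\<close> to the shadow of \<open>T A\<close> along \<open>T u\<close>. So it suffices to bring
  each point of a moved copy of \<open>A\<close> into the interior of \<open>B\<close> by a shift along \<open>T u\<close>; the shift may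
  depend on the point, since the projection forgets it.
\<close>

lemma can_rupert_of_rigid_motion:
  fixes T :: "real^3 \<Rightarrow> real^3"
  assumes T: "orthogonal_transformation T" and u: "norm u = 1"
    and shift: "\<And>x. x \<in> A \<Longrightarrow> \<exists>s. c + T x + s *\<^sub>R T u \<in> interior B"
  shows "can_rupert A B"
proof -
  define v where "v = T u"
  define f where "f x = plane_proj v c + T x" for x
  have lin: "linear T" and inn: "\<And>x y. T x \<bullet> T y = x \<bullet> y"
    using T by (auto simp: orthogonal_transformation_def)
  have v: "norm v = 1"
    using T u by (simp add: v_def orthogonal_transformation_norm)
  have vv: "v \<bullet> v = 1"
    using v by (simp add: dot_square_norm)
  have cv: "plane_proj v c \<bullet> v = 0"
    using vv by (simp add: plane_proj_def inner_diff_left)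
  have plane: "x \<in> {w}\<^sup>\<bottom> \<longleftrightarrow> x \<bullet> w = 0" for x w :: "real^3"
    by (auto simp: orthogonal_comp_def orthogonal_def inner_commute)
  have "f ` ({u}\<^sup>\<bottom>) = {v}\<^sup>\<bottom>"
  proof (intro subset_antisym subsetI)
    fix y assume "y \<in> f ` ({u}\<^sup>\<bottom>)"
    then show "y \<in> {v}\<^sup>\<bottom>"
      using cv by (auto simp: plane f_def v_def inner_add_left inn)
  next
    fix y assume y: "y \<in> {v}\<^sup>\<bottom>"
    obtain x where x: "y - plane_proj v c = T x"
      using orthogonal_transformation_surj[OF T] by (metis surjD)
    have "x \<bullet> u = T x \<bullet> v"
      by (simp add: v_def inn)
    also have "\<dots> = 0"
      using y cv by (simp add: plane inner_diff_left flip: x)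
    finally have "x \<in> {u}\<^sup>\<bottom>"
      by (simp add: plane)
    moreover have "y = f x"
      by (simp add: f_def flip: x)
    ultimately show "y \<in> f ` ({u}\<^sup>\<bottom>)"
      by blast
  qed
  moreover have "dist (f x) (f y) = dist x y" for x y
    using T by (simp add: f_def orthogonal_transformation_isometry)
  ultimately have "isometry_betw f ({u}\<^sup>\<bottom>) ({v}\<^sup>\<bottom>)"
    by (simp add: isometry_betw_def)
  moreover have "f ` (plane_proj u ` A) \<subseteq> plane_proj v ` interior B"
  proof clarify
    fix x assume "x \<in> A"
    then obtain s where s: "c + T x + s *\<^sub>R v \<in> interior B"
      using shift by (auto simp: v_def)
    have "T x \<bullet> v = x \<bullet> u"
      by (simp add: v_def inn)
    then have "f (plane_proj u x) = plane_proj v (c + T x + s *\<^sub>R v)"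
      using vv
      by (simp add: f_def plane_proj_def v_def linear_diff[OF lin] linear_cmul[OF lin]
          inner_add_left algebra_simps)
    then show "f (plane_proj u x) \<in> plane_proj v ` interior B"
      using s by blast
  qed
  ultimately show ?thesis
    unfolding can_rupert_def using u v plane_proj_interior_subset[OF v, of B] by blast
qed

section \<open>Supporting planes and width\<close>

lemma bdd_inner_compact:
  fixes A :: "'a::real_inner set"
  assumes "compact A"
  shows "bdd_above ((\<lambda>x. x \<bullet> u) ` A)" "bdd_below ((\<lambda>x. x \<bullet> u) ` A)"
proof -
  have "compact ((\<lambda>x. x \<bullet> u) ` A)"
    by (intro compact_continuous_image continuous_intros assms)
  then have "bounded ((\<lambda>x. x \<bullet> u) ` A)"
    by (rule compact_imp_bounded)
  then show "bdd_above ((\<lambda>x. x \<bullet> u) ` A)" "bdd_below ((\<lambda>x. x \<bullet> u) ` A)"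
    by (auto intro: bounded_imp_bdd_above bounded_imp_bdd_below)
qed

lemma inner_between_supports:
  assumes "compact A" "x \<in> A"
  shows "(INF x\<in>A. x \<bullet> u) \<le> x \<bullet> u" "x \<bullet> u \<le> (INF x\<in>A. x \<bullet> u) + width A u"
  using cINF_lower[OF bdd_inner_compact(2)[OF assms(1)] assms(2)]
    cSUP_upper[OF assms(2) bdd_inner_compact(1)[OF assms(1)]]
  by (auto simp: width_def)

lemma width_nonneg:
  assumes "compact A" "A \<noteq> {}"
  shows "0 \<le> width A u"
  using assms inner_between_supports[of A _ u] by fastforce

lemma exists_far_points_of_width:
  assumes A: "compact A" "A \<noteq> {}" and u: "norm u = 1" and h: "h < width A u"
  obtains p q where "p \<in> A" "q \<in> A" "h < dist p q"
proof -
  have "h + (INF x\<in>A. x \<bullet> u) < (SUP x\<in>A. x \<bullet> u)"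
    using h by (simp add: width_def)
  then obtain p where p: "p \<in> A" "h + (INF x\<in>A. x \<bullet> u) < p \<bullet> u"
    using A bdd_inner_compact(1)[OF A(1)] by (auto simp: less_cSUP_iff)
  then have "(INF x\<in>A. x \<bullet> u) < p \<bullet> u - h"
    by simp
  then obtain q where q: "q \<in> A" "q \<bullet> u < p \<bullet> u - h"
    using A bdd_inner_compact(2)[OF A(1)] by (auto simp: cINF_less_iff)
  have "h < (p - q) \<bullet> u"
    using q by (simp add: inner_diff_left)
  also have "\<dots> \<le> dist p q"
    using norm_cauchy_schwarz[of "p - q" u] u by (simp add: dist_norm)
  finally show ?thesis
    using p q that by blast
qed

section \<open>The two passages\<close>

text \<open>
  The transformation sends the long edge of the cuboid to the direction of projection and the edge
  of length \<open>h\<close> into the segment between two interior points. By compactness this piece of segment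
  stays inside the solid when thickened by a small amount, in particular by the edge of length \<open>\<epsilon>\<close>.
\<close>

lemma cuboid_can_rupert_between_far_points:
  assumes A: "convex_solid A" and pq: "p \<in> A" "q \<in> A" "h < dist p q" and h: "0 < h"
  obtains \<eta> where "\<eta> > 0" "\<And>L \<epsilon>. \<epsilon> < \<eta> \<Longrightarrow> can_rupert (cuboid L h \<epsilon>) A"
proof -
  have "closure (interior A) = closure A"
    using A by (intro convex_closure_interior) (auto simp: convex_solid_def)
  then have cl: "p \<in> closure (interior A)" "q \<in> closure (interior A)"
    using pq closure_subset by blast+
  define r where "r = (dist p q - h) / 2"
  have r: "r > 0"
    using pq by (simp add: r_def)
  obtain p' where p': "p' \<in> interior A" "dist p' p < r"
    using cl(1) r by (auto simp: closure_approachable)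
  obtain q' where q': "q' \<in> interior A" "dist q' q < r"
    using cl(2) r by (auto simp: closure_approachable)
  have "dist p q \<le> dist p' p + dist p' q' + dist q' q"
    using dist_triangle[of p q p'] dist_triangle[of p' q q'] by (simp add: dist_commute)
  then have far: "h < dist p' q'"
    using p'(2) q'(2) unfolding r_def by argo
  define d where "d = (q' - p') /\<^sub>R dist p' q'"
  have "dist p' q' \<noteq> 0"
    using far h by linarith
  then have d: "norm d = 1"
    by (simp add: d_def dist_norm norm_minus_commute)
  define S where "S = (\<lambda>s. p' + s *\<^sub>R d) ` {0..h}"
  have S: "S \<subseteq> interior A"
  proof
    fix y assume "y \<in> S"
    then obtain s where s: "0 \<le> s" "s \<le> h" "y = p' + s *\<^sub>R d"
      by (auto simp: S_def)
    define t where "t = s / dist p' q'"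
    have t: "0 \<le> t" "t \<le> 1"
      using s far h by (auto simp: t_def divide_simps)
    have y: "y = (1 - t) *\<^sub>R p' + t *\<^sub>R q'"
      using s by (simp add: t_def d_def algebra_simps divide_inverse)
    have "convex (interior A)"
      using A by (simp add: convex_solid_def)
    then show "y \<in> interior A"
      unfolding y using t p' q' by (intro convexD_alt) auto
  qed
  have "compact S"
    unfolding S_def by (intro compact_continuous_image continuous_intros) auto
  then obtain \<eta> where \<eta>: "\<eta> > 0" "(\<Union>x\<in>S. ball x \<eta>) \<subseteq> interior A"
    using compact_subset_open_imp_ball_epsilon_subset[OF _ _ S] by auto
  obtain T where T: "orthogonal_transformation T" "T (axis 2 1 :: real^3) = d"
    using orthogonal_transformation_exists_1[of "axis 2 1 :: real^3" d] d by (auto simp: norm_axis_1)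
  have lin: "linear T"
    using T by (simp add: orthogonal_transformation_def)
  have "can_rupert (cuboid L h \<epsilon>) A" if \<epsilon>: "\<epsilon> < \<eta>" for L \<epsilon>
  proof (rule can_rupert_of_rigid_motion[OF T(1), where u = "axis 1 1" and c = p'])
    fix x :: "real^3" assume "x \<in> cuboid L h \<epsilon>"
    then have x: "0 \<le> x$2" "x$2 \<le> h" "0 \<le> x$3" "x$3 \<le> \<epsilon>"
      by (auto simp: mem_cuboid)
    have "x = x$1 *\<^sub>R axis 1 1 + x$2 *\<^sub>R axis 2 1 + x$3 *\<^sub>R axis 3 1"
      by (simp add: vec_eq_iff forall_3 axis_def)
    then have "T x = T (x$1 *\<^sub>R axis 1 1 + x$2 *\<^sub>R axis 2 1 + x$3 *\<^sub>R axis 3 1)"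
      by (rule arg_cong)
    then have Tx: "T x = x$1 *\<^sub>R T (axis 1 1) + x$2 *\<^sub>R d + x$3 *\<^sub>R T (axis 3 1)"
      by (simp add: linear_add[OF lin] linear_cmul[OF lin] T(2))
    have "p' + x$2 *\<^sub>R d \<in> S"
      using x by (auto simp: S_def)
    moreover have "p' + T x + (- x$1) *\<^sub>R T (axis 1 1) \<in> ball (p' + x$2 *\<^sub>R d) \<eta>"
      using x \<epsilon> T(1) by (simp add: Tx dist_norm orthogonal_transformation_norm norm_axis_1)
    ultimately show "\<exists>s. p' + T x + s *\<^sub>R T (axis 1 1) \<in> interior A"
      using \<eta>(2) by blast
  qed (simp add: norm_axis_1)
  then show ?thesis
    using \<eta>(1) that by blast
qed

text \<open>
  The thin direction of \<open>A\<close> is turned to the edge of length \<open>h\<close>, and the shadow is centred in the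
  \<open>L\<close> by \<open>h\<close> rectangle. The coordinate along the edge of length \<open>\<epsilon>\<close> is projected away, so each
  point can be shifted to mid-height \<open>\<epsilon>/2\<close>.
\<close>

lemma can_rupert_cuboid_of_width_less:
  assumes A: "compact A" and u: "norm u = 1" and h: "width A u < h"
    and R: "\<And>x. x \<in> A \<Longrightarrow> norm x \<le> R" and L: "2 * R < L" and \<epsilon>: "0 < \<epsilon>"
  shows "can_rupert A (cuboid L h \<epsilon>)"
proof -
  obtain T where T: "orthogonal_transformation T" "T u = (axis 2 1 :: real^3)"
    using orthogonal_transformation_exists_1[of u "axis 2 1 :: real^3"] u by (auto simp: norm_axis_1)
  have inn: "T x \<bullet> T y = x \<bullet> y" for x y
    using T by (auto simp: orthogonal_transformation_def)
  obtain w where w: "axis 3 1 = T w"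
    using orthogonal_transformation_surj[OF T(1)] by (metis surjD)
  have norm_w: "norm w = 1"
    using orthogonal_transformation_norm[OF T(1), of w] by (simp add: norm_axis_1 flip: w)
  define m where "m = (INF x\<in>A. x \<bullet> u)"
  define c :: "real^3" where "c = vector [L/2, (h - width A u) / 2 - m, 0]"
  show ?thesis
  proof (rule can_rupert_of_rigid_motion[OF T(1) norm_w, where c = c])
    fix x assume x: "x \<in> A"
    have "\<bar>(T x)$1\<bar> \<le> R"
      using component_le_norm_cart[of "T x" 1] orthogonal_transformation_norm[OF T(1), of x] R[OF x]
      by simp
    then have 1: "0 < L/2 + (T x)$1" "L/2 + (T x)$1 < L"
      using L by (auto simp: abs_le_iff field_simps)
    have "(T x)$2 = x \<bullet> u"
      using inn[of x u] by (simp add: T(2) inner_axis)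
    moreover have "m \<le> x \<bullet> u" "x \<bullet> u \<le> m + width A u"
      unfolding m_def by (rule inner_between_supports[OF A x])+
    ultimately have 2: "0 < (h - width A u) / 2 - m + (T x)$2" "(h - width A u) / 2 - m + (T x)$2 < h"
      using h by (auto simp: field_simps)
    have "c + T x + (\<epsilon>/2 - (T x)$3) *\<^sub>R T w \<in> box 0 (vector [L, h, \<epsilon>])"
      using 1 2 \<epsilon> by (simp add: mem_box_cart forall_3 c_def axis_def flip: w)
    then show "\<exists>s. c + T x + s *\<^sub>R T w \<in> interior (cuboid L h \<epsilon>)"
      by (auto simp: cuboid_def interior_cbox)
  qed
qed

section \<open>Friendly butterflies\<close>

theorem proposition1:
  fixes A :: "(real^3) set"
  assumes "convex_solid A"
    and "\<not> constant_width A"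
  shows "\<forall>M \<delta> K :: real. M > 0 \<longrightarrow> \<delta> > 0 \<longrightarrow> K > 1 \<longrightarrow>
    (\<exists>L h \<epsilon> :: real. L > 0 \<and> h > 0 \<and> \<epsilon> > 0 \<and> L \<ge> K * h \<and> h \<ge> K * \<epsilon> \<and>
      L > M \<and> \<epsilon> < \<delta> \<and> friends (cuboid L h \<epsilon>) A)"
proof (intro allI impI)
  fix M \<delta> K :: real
  assume M: "M > 0" and \<delta>: "\<delta> > 0" and K: "K > 1"
  have A: "compact A" "A \<noteq> {}"
    using assms(1) interior_subset by (auto simp: convex_solid_def)
  obtain u where u: "norm u = 1" "width A u \<noteq> width A (axis 1 1)"
    using assms by (auto simp: constant_width_def)
  obtain a b where ab: "norm a = 1" "norm b = 1" "width A a < width A b"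
    using u norm_axis_1 by (metis linorder_neqE)
  then obtain h where h: "width A a < h" "h < width A b"
    using dense by blast
  have "0 < h"
    using width_nonneg[OF A, of a] h by simp
  obtain p q where "p \<in> A" "q \<in> A" "h < dist p q"
    using exists_far_points_of_width[OF A ab(2) h(2)] .
  then obtain \<eta> where \<eta>: "\<eta> > 0" "\<And>L \<epsilon>. \<epsilon> < \<eta> \<Longrightarrow> can_rupert (cuboid L h \<epsilon>) A"
    using cuboid_can_rupert_between_far_points[OF assms(1) _ _ _ \<open>0 < h\<close>] by metis
  obtain R where R: "\<And>x. x \<in> A \<Longrightarrow> norm x \<le> R"
    using compact_imp_bounded[OF A(1)] by (auto simp: bounded_iff)
  define L where "L = max (K * h) (max M (2 * R)) + 1"
  define \<epsilon> where "\<epsilon> = min (h / K) (min \<delta> \<eta>) / 2"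
  have L: "L \<ge> K * h" "L > M" "2 * R < L" "L > 0"
    using M by (auto simp: L_def)
  have pos: "0 < min (h / K) (min \<delta> \<eta>)"
    using \<open>0 < h\<close> K \<delta> \<eta> by simp
  then have "\<epsilon> > 0" "\<epsilon> < min (h / K) (min \<delta> \<eta>)"
    unfolding \<epsilon>_def by argo+
  then have \<epsilon>: "\<epsilon> > 0" "\<epsilon> < \<delta>" "\<epsilon> < \<eta>" "\<epsilon> \<le> h / K"
    by auto
  have "h \<ge> K * \<epsilon>"
    using \<epsilon>(4) K by (simp add: field_simps)
  moreover have "friends (cuboid L h \<epsilon>) A"
    unfolding friends_def
    using assms(1) convex_solid_cuboid[OF L(4) \<open>0 < h\<close> \<epsilon>(1)] \<eta>(2)[OF \<epsilon>(3)]
      can_rupert_cuboid_of_width_less[OF A(1) ab(1) h(1) R L(3) \<epsilon>(1)] by blast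
  ultimately show "\<exists>L h \<epsilon> :: real. L > 0 \<and> h > 0 \<and> \<epsilon> > 0 \<and> L \<ge> K * h \<and> h \<ge> K * \<epsilon> \<and>
      L > M \<and> \<epsilon> < \<delta> \<and> friends (cuboid L h \<epsilon>) A"
    using L \<epsilon> \<open>0 < h\<close> by blast
qed

end
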